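(* Let $0 < \varepsilon \leq 1$, let $k \geq 1$ be an integer, let $X \subseteq \mathbb{R}^d$ be any finite dataset, and let $S$ be a $(k, \varepsilon^2/32)$-geometric-coreset of $X$. Define $w : S \to \mathbb{R}^{+}$ by $w(s) = |\mathcal{N}_X(s)|$ for all $s \in S$. Then $S$ together with the weight function $w$ is a $(k, \varepsilon)$-coreset of $X$.
   Context: For finite $C, X \subseteq \mathbb{R}^d$, $\Phi(C, X) = \sum_{x \in X} \min_{c \in C} \|x - c\|^2$, and with a weight function $w$ on $S$, $\Phi(C, S, w) = \sum_{s \in S} w(s) \min_{c \in C} \|s - c\|^2$. $\Delta_k(X)$ is the minimum of $\Phi(C, X)$ over all sets $C \subseteq \mathbb{R}^d$ of $k$ centers. A $(k, \delta)$-geometric-coreset of $X$ is a finite set $S \subseteq \mathbb{R}^d$ with $\Phi(S, X) \leq \delta \cdot \Delta_k(X)$. For $y \in S$, $\mathcal{N}_X(y) = \{x \in X : \arg\min_{p \in S} \|x - p\| = y\}$, the points of $X$ whose closest point in $S$ is $y$ (each point of $X$ assigned to exactly one closest point of $S$). A $(k, \varepsilon)$-coreset of $X$ is a set $S \subseteq \mathbb{R}^d$ with a weight function $w : S \to \mathbb{R}^{+}$ such that for every set $C \subseteq \mathbb{R}^d$ of $k$ centers, $(1-\varepsilon)\Phi(C, X) \leq \Phi(C, S, w) \leq (1+\varepsilon)\Phi(C, X)$. *)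

theory Defs
  imports "HOL-Analysis.Analysis"
begin

text \<open>
  Costs are meant for nonempty sets of centers; over the empty set \<^const>\<open>Min\<close> is unspecified.
\<close>

definition cost :: "'a::euclidean_space set \<Rightarrow> 'a set \<Rightarrow> real" where
  "cost C X = (\<Sum>x\<in>X. Min ((\<lambda>c. (norm (x - c))\<^sup>2) ` C))"

definition weighted_cost :: "'a::euclidean_space set \<Rightarrow> 'a set \<Rightarrow> ('a \<Rightarrow> real) \<Rightarrow> real" where
  "weighted_cost C S w = (\<Sum>s\<in>S. w s * Min ((\<lambda>c. (norm (s - c))\<^sup>2) ` C))"

text \<open>
  The infimum below is a minimum for finite \<open>X\<close> and \<open>k \<ge> 1\<close>, see \<open>opt_cost_attained\<close>.
\<close>

definition opt_cost :: "nat \<Rightarrow> 'a::euclidean_space set \<Rightarrow> real" where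
  "opt_cost k X = (INF C \<in> {C. finite C \<and> card C = k}. cost C X)"

text \<open>
  The second conjunct excludes the empty set of centers for a nonempty dataset, whose cost is
  infinite by convention.
\<close>

definition geometric_coreset ::
    "nat \<Rightarrow> real \<Rightarrow> 'a::euclidean_space set \<Rightarrow> 'a set \<Rightarrow> bool" where
  "geometric_coreset k \<delta> X S \<longleftrightarrow>
     finite S \<and> (X \<noteq> {} \<longrightarrow> S \<noteq> {}) \<and> cost S X \<le> \<delta> * opt_cost k X"

text \<open>
  A closest point need not be unique; \<open>a\<close> is a choice of one closest point of \<open>S\<close> for each point
  of \<open>X\<close>, with ties broken arbitrarily. The sets \<open>nearest_cell X a y\<close> then partition \<open>X\<close>.
\<close>

definition nearest_assignment ::
    "'a::euclidean_space set \<Rightarrow> 'a set \<Rightarrow> ('a \<Rightarrow> 'a) \<Rightarrow> bool" where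
  "nearest_assignment S X a \<longleftrightarrow>
     (\<forall>x\<in>X. is_arg_min (\<lambda>p. norm (x - p)) (\<lambda>p. p \<in> S) (a x))"

definition nearest_cell :: "'a set \<Rightarrow> ('a \<Rightarrow> 'a) \<Rightarrow> 'a \<Rightarrow> 'a set" where
  "nearest_cell X a y = {x \<in> X. a x = y}"

text \<open>
  Weights may be zero: a point of \<open>S\<close> which is closest to no point of \<open>X\<close> has an empty cell.
\<close>

definition coreset ::
    "nat \<Rightarrow> real \<Rightarrow> 'a::euclidean_space set \<Rightarrow> 'a set \<Rightarrow> ('a \<Rightarrow> real) \<Rightarrow> bool" where
  "coreset k \<epsilon> X S w \<longleftrightarrow>
     finite S \<and> (\<forall>s\<in>S. 0 \<le> w s) \<and>
     (\<forall>C. finite C \<and> card C = k \<longrightarrow>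
        (1 - \<epsilon>) * cost C X \<le> weighted_cost C S w \<and>
        weighted_cost C S w \<le> (1 + \<epsilon>) * cost C X)"

lemma nearest_assignment_exists:
  assumes "finite S" "S \<noteq> {}"
  shows "\<exists>a. nearest_assignment S X a"
proof
  show "nearest_assignment S X (\<lambda>x. SOME p. is_arg_min (\<lambda>p. norm (x - p)) (\<lambda>p. p \<in> S) p)"
    unfolding nearest_assignment_def
    by (rule ballI, rule someI_ex, rule ex_is_arg_min_if_finite[OF assms])
qed

lemma cost_antimono:
  assumes "T \<subseteq> C" "T \<noteq> {}" "finite C"
  shows "cost C X \<le> cost T X"
  unfolding cost_def using assms by (intro sum_mono Min_antimono) auto

lemma centroid_le:
  fixes c :: "'a::euclidean_space"
  assumes "finite A" "A \<noteq> {}" and m: "m = (1 / real (card A)) *\<^sub>R (\<Sum>x\<in>A. x)"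
  shows "(\<Sum>x\<in>A. (norm (x - m))\<^sup>2) \<le> (\<Sum>x\<in>A. (norm (x - c))\<^sup>2)"
proof -
  have "real (card A) \<noteq> 0" using assms by auto
  then have z: "(\<Sum>x\<in>A. x - m) = 0"
    by (simp add: sum_subtractf m sum_constant_scaleR)
  have "(\<Sum>x\<in>A. (norm (x - c))\<^sup>2) =
      (\<Sum>x\<in>A. (norm (x - m))\<^sup>2 + 2 * ((x - m) \<bullet> (m - c)) + (norm (m - c))\<^sup>2)"
    by (intro sum.cong refl) (simp add: power2_norm_eq_inner algebra_simps inner_commute)
  also have "\<dots> =
      (\<Sum>x\<in>A. (norm (x - m))\<^sup>2) + 2 * ((\<Sum>x\<in>A. x - m) \<bullet> (m - c)) + card A * (norm (m - c))\<^sup>2"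
    by (simp only: sum.distrib sum_distrib_left inner_sum_left sum_constant)
  finally show ?thesis using z by simp
qed

lemma opt_cost_attained:
  fixes X :: "'a::euclidean_space set"
  assumes "finite X" "k \<ge> 1"
  shows "\<exists>C. finite C \<and> card C = k \<and> cost C X = opt_cost k X \<and>
           (\<forall>D. finite D \<and> card D = k \<longrightarrow> cost C X \<le> cost D X)"
proof -
  have inf: "infinite (UNIV :: 'a set)"
  proof -
    obtain b :: 'a where "b \<noteq> 0" using nonempty_Basis nonzero_Basis by blast
    then have "inj (\<lambda>n. real n *\<^sub>R b)" by (auto simp: inj_on_def)
    then show ?thesis using finite_subset[OF subset_UNIV] range_inj_infinite by blast
  qed
  have "\<exists>C. finite C \<and> card C = k \<and> (\<forall>D. finite D \<and> card D = k \<longrightarrow> cost C X \<le> cost D X)"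
  proof (cases "X = {}")
    case True
    obtain C :: "'a set" where "finite C" "card C = k"
      using infinite_arbitrarily_large[OF inf] by blast
    then show ?thesis using True by (auto simp: cost_def)
  next
    case False
    define cen :: "'a set \<Rightarrow> 'a" where "cen A = (1 / real (card A)) *\<^sub>R (\<Sum>x\<in>A. x)" for A
    define F where "F = {T. T \<subseteq> cen ` Pow X \<and> T \<noteq> {} \<and> card T \<le> k}"
    have "finite F"
      unfolding F_def by (rule finite_subset[of _ "Pow (cen ` Pow X)"]) (use assms in auto)
    have red: "\<exists>T\<in>F. cost T X \<le> cost C X" if C: "finite C" "card C = k" for C
    proof -
      have "C \<noteq> {}" using C assms by auto
      define f where "f x = arg_min_on (\<lambda>c. (norm (x - c))\<^sup>2) C" for x
      have f1: "f x \<in> C" for x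
        unfolding f_def using C(1) \<open>C \<noteq> {}\<close> by (rule arg_min_if_finite(1))
      have f2: "(norm (x - f x))\<^sup>2 = Min ((\<lambda>c. (norm (x - c))\<^sup>2) ` C)" for x
      proof (rule Min_eqI[symmetric])
        fix y assume "y \<in> (\<lambda>c. (norm (x - c))\<^sup>2) ` C"
        then show "(norm (x - f x))\<^sup>2 \<le> y"
          unfolding f_def using arg_min_least[OF C(1) \<open>C \<noteq> {}\<close>, of _ "\<lambda>c. (norm (x - c))\<^sup>2"] by auto
      qed (use C f1 in auto)
      define A where "A c = {x \<in> X. f x = c}" for c
      define T where "T = (\<lambda>c. cen (A c)) ` (f ` X)"
      have fT: "finite T" "T \<noteq> {}" unfolding T_def using assms False by auto
      have "card T \<le> card (f ` X)" unfolding T_def using assms by (intro card_image_le) auto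
      also have "\<dots> \<le> card C" using f1 C by (intro card_mono) auto
      finally have "T \<in> F" using fT C unfolding F_def T_def A_def by auto
      have "cost T X = (\<Sum>c\<in>f ` X. \<Sum>x\<in>A c. Min ((\<lambda>t. (norm (x - t))\<^sup>2) ` T))"
        unfolding cost_def A_def using assms by (intro sum.image_gen) auto
      also have "\<dots> \<le> (\<Sum>c\<in>f ` X. \<Sum>x\<in>A c. (norm (x - cen (A c)))\<^sup>2)"
        using fT by (intro sum_mono Min_le) (auto simp: T_def)
      also have "\<dots> \<le> (\<Sum>c\<in>f ` X. \<Sum>x\<in>A c. (norm (x - c))\<^sup>2)"
        using assms by (intro sum_mono centroid_le) (auto simp: A_def cen_def)
      also have "\<dots> = (\<Sum>c\<in>f ` X. \<Sum>x\<in>A c. (norm (x - f x))\<^sup>2)"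
        by (intro sum.cong) (auto simp: A_def)
      also have "\<dots> = (\<Sum>x\<in>X. (norm (x - f x))\<^sup>2)"
        unfolding A_def using assms by (intro sum.image_gen[symmetric]) auto
      also have "\<dots> = cost C X" by (simp add: cost_def f2)
      finally show ?thesis using \<open>T \<in> F\<close> by blast
    qed
    obtain C0 :: "'a set" where "finite C0" "card C0 = k"
      using infinite_arbitrarily_large[OF inf] by blast
    then have "F \<noteq> {}" using red by blast
    then obtain T where "is_arg_min (\<lambda>T. cost T X) (\<lambda>T. T \<in> F) T"
      using ex_is_arg_min_if_finite[OF \<open>finite F\<close>] by blast
    then have T: "T \<in> F" "\<And>U. U \<in> F \<Longrightarrow> cost T X \<le> cost U X"
      by (auto simp: is_arg_min_linorder)
    have tT: "finite T" "T \<noteq> {}" "card T \<le> k"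
      using T(1) assms finite_subset[of T "cen ` Pow X"] unfolding F_def by auto
    have "infinite (- T)" using inf tT(1) by (simp add: Compl_eq_Diff_UNIV)
    then obtain B where B: "finite B" "card B = k - card T" "B \<subseteq> - T"
      using infinite_arbitrarily_large by blast
    have "card (T \<union> B) = k" using B tT by (subst card_Un_disjoint) auto
    moreover have leT: "cost (T \<union> B) X \<le> cost T X" using B tT by (intro cost_antimono) auto
    moreover have "cost (T \<union> B) X \<le> cost D X" if D: "finite D" "card D = k" for D
    proof -
      obtain U where "U \<in> F" "cost U X \<le> cost D X" using red[OF D] by blast
      then show ?thesis using T(2)[of U] leT by linarith
    qed
    moreover have "finite (T \<union> B)" using B(1) tT(1) by simp
    ultimately show ?thesis by (intro exI[of _ "T \<union> B"] conjI allI impI) simp_all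
  qed
  then obtain C where C: "finite C" "card C = k"
    "\<And>D. finite D \<Longrightarrow> card D = k \<Longrightarrow> cost C X \<le> cost D X" by blast
  have "opt_cost k X = cost C X"
    unfolding opt_cost_def using C by (intro cInf_eq_minimum) auto
  then show ?thesis using C by (intro exI[of _ C]) simp
qed

end

theory Submission
  imports Defs
begin

text \<open>
  With \<open>a\<close> the chosen assignment, the weighted cost of \<open>S\<close> is the sum over \<open>x\<close> of the squared distance
  of \<open>a x\<close> to \<open>C\<close>. The distance to \<open>C\<close> is 1-Lipschitz, so moving \<open>x\<close> to \<open>a x\<close>, a distance \<open>r\<close>, changes
  the squared distance \<open>p\<^sup>2\<close> to \<open>C\<close> by at most \<open>2 p r + r\<^sup>2 \<le> \<epsilon>/2 \<sqdot> p\<^sup>2 + (2/\<epsilon> + 1) r\<^sup>2\<close>. Summing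
  over \<open>X\<close>, the \<open>r\<^sup>2\<close> add up to the cost of \<open>S\<close>, which is at most \<open>\<epsilon>\<^sup>2/32\<close> times the cost of \<open>C\<close>, and
  \<open>\<epsilon>/2 + (2/\<epsilon> + 1) \<epsilon>\<^sup>2/32 \<le> \<epsilon>\<close>.
\<close>

text \<open>Gives access to the triangle inequality for \<open>infdist\<close>. A finite set is
  closed, so the infimum is attained at one of the centers.\<close>

lemma Min_norm_power2_eq_infdist:
  fixes x :: "'a::euclidean_space"
  assumes "finite C" "C \<noteq> {}"
  shows "Min ((\<lambda>c. (norm (x - c))\<^sup>2) ` C) = (infdist x C)\<^sup>2"
proof (rule Min_eqI)
  show "(infdist x C)\<^sup>2 \<le> y" if "y \<in> (\<lambda>c. (norm (x - c))\<^sup>2) ` C" for y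
    using that by (auto simp flip: dist_norm intro!: power_mono infdist_le infdist_nonneg)
  obtain c where "c \<in> C" "infdist x C = dist x c"
    using infdist_attains_inf[OF finite_imp_closed[OF assms(1)] assms(2)] by blast
  then show "(infdist x C)\<^sup>2 \<in> (\<lambda>c. (norm (x - c))\<^sup>2) ` C"
    by (auto simp: dist_norm)
qed (use assms in simp)

lemma cost_eq_sum_infdist:
  assumes "finite C" "C \<noteq> {}"
  shows "cost C X = (\<Sum>x\<in>X. (infdist x C)\<^sup>2)"
  unfolding cost_def by (simp add: Min_norm_power2_eq_infdist[OF assms])

lemma cost_nonneg:
  assumes "finite C" "C \<noteq> {}"
  shows "0 \<le> cost C X"
  unfolding cost_eq_sum_infdist[OF assms] by (intro sum_nonneg) auto

lemma opt_cost_le_cost: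
  fixes X :: "'a::euclidean_space set"
  assumes "finite X" "k \<ge> 1" "finite C" "card C = k"
  shows "opt_cost k X \<le> cost C X"
  using opt_cost_attained[OF assms(1,2)] assms(3,4) by metis

lemma nearest_assignment_in:
  assumes "nearest_assignment S X a" "x \<in> X"
  shows "a x \<in> S"
  using assms by (auto simp: nearest_assignment_def is_arg_min_def)

text \<open>Squaring is monotone on norms, so every closest point attains the minimum of the
  squares, however \<open>a\<close> breaks ties.\<close>

lemma cost_eq_sum_nearest_assignment:
  fixes X :: "'a::euclidean_space set"
  assumes "finite S" "nearest_assignment S X a"
  shows "cost S X = (\<Sum>x\<in>X. (norm (x - a x))\<^sup>2)"
  unfolding cost_def
proof (intro sum.cong refl Min_eqI)
  fix x y assume "x \<in> X" "y \<in> (\<lambda>c. (norm (x - c))\<^sup>2) ` S"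
  then show "(norm (x - a x))\<^sup>2 \<le> y"
    using assms by (auto simp: nearest_assignment_def is_arg_min_linorder intro!: power_mono)
qed (use assms nearest_assignment_in[OF assms(2)] in auto)

text \<open>The cells are the fibres of \<open>a\<close> and partition \<open>X\<close> because
  \<open>a\<close> maps \<open>X\<close> into \<open>S\<close>; the weight \<open>w s\<close> counts
  how often the term of \<open>s\<close> occurs.\<close>

lemma weighted_cost_cells_eq_sum:
  fixes X :: "'a::euclidean_space set"
  assumes "finite X" "finite S" "a ` X \<subseteq> S" "C \<noteq> {}" "finite C"
    and w: "\<And>s. s \<in> S \<Longrightarrow> w s = real (card (nearest_cell X a s))"
  shows "weighted_cost C S w = (\<Sum>x\<in>X. (infdist (a x) C)\<^sup>2)"
proof -
  have "(\<Sum>x\<in>X. (infdist (a x) C)\<^sup>2) = (\<Sum>s\<in>S. \<Sum>x\<in>nearest_cell X a s. (infdist (a x) C)\<^sup>2)"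
    unfolding nearest_cell_def using assms by (intro sum.group[symmetric]) auto
  also have "\<dots> = (\<Sum>s\<in>S. \<Sum>x\<in>nearest_cell X a s. (infdist s C)\<^sup>2)"
    by (intro sum.cong) (auto simp: nearest_cell_def)
  also have "\<dots> = weighted_cost C S w"
    unfolding weighted_cost_def using assms by (simp add: Min_norm_power2_eq_infdist)
  finally show ?thesis by simp
qed

lemma abs_diff_power2_le:
  fixes p q r \<epsilon> :: real
  assumes "0 < \<epsilon>" "0 \<le> p" "0 \<le> q" "\<bar>q - p\<bar> \<le> r"
  shows "\<bar>q\<^sup>2 - p\<^sup>2\<bar> \<le> \<epsilon> / 2 * p\<^sup>2 + (2 / \<epsilon> + 1) * r\<^sup>2"
proof -
  have "\<bar>q\<^sup>2 - p\<^sup>2\<bar> = \<bar>q - p\<bar> * (p + q)"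
    using assms by (simp add: power2_eq_square square_diff_square_factored abs_mult)
  also have "\<dots> \<le> r * (2 * p + r)"
    using assms by (intro mult_mono) auto
  also have "\<dots> \<le> \<epsilon> / 2 * p\<^sup>2 + (2 / \<epsilon> + 1) * r\<^sup>2"
  proof -
    \<comment> \<open>Weighted AM-GM: the square is scaled to have cross term
      \<open>- 2 * p * r\<close> and coefficient \<open>\<epsilon> / 2\<close> at
      \<open>p\<^sup>2\<close>.\<close>
    have "0 \<le> (\<epsilon> * p - 2 * r)\<^sup>2 / (2 * \<epsilon>)" using assms by simp
    also have "\<dots> = \<epsilon> / 2 * p\<^sup>2 + 2 / \<epsilon> * r\<^sup>2 - 2 * p * r"
      using assms by (simp add: power2_eq_square field_simps)
    finally show ?thesis by (simp add: power2_eq_square algebra_simps)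
  qed
  finally show ?thesis .
qed

lemma abs_diff_infdist_le:
  "\<bar>infdist y C - infdist x C\<bar> \<le> dist x y"
  using infdist_triangle[of x C y] infdist_triangle[of y C x] by (simp add: dist_commute abs_le_iff)

theorem theorem5:
  fixes X S :: "(real ^ 'd) set" and a :: "real ^ 'd \<Rightarrow> real ^ 'd"
    and w :: "real ^ 'd \<Rightarrow> real" and k :: nat and \<epsilon> :: real
  assumes "0 < \<epsilon>" "\<epsilon> \<le> 1" "k \<ge> 1" "finite X"
    and "geometric_coreset k (\<epsilon>\<^sup>2 / 32) X S"
    and "nearest_assignment S X a"
    and "\<And>s. s \<in> S \<Longrightarrow> w s = real (card (nearest_cell X a s))"
  shows "coreset k \<epsilon> X S w"
proof -
  have S: "finite S" "cost S X \<le> \<epsilon>\<^sup>2 / 32 * opt_cost k X"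
    using assms(5) by (auto simp: geometric_coreset_def)
  have "\<bar>weighted_cost C S w - cost C X\<bar> \<le> \<epsilon> * cost C X" if C: "finite C" "card C = k" for C
  proof -
    \<comment> \<open>The bound \<open>k \<ge> 1\<close> excludes the empty set of centers, for
      which \<open>Min\<close> is unspecified.\<close>
    have C0: "C \<noteq> {}" using C assms(3) by auto
    have wc: "weighted_cost C S w = (\<Sum>x\<in>X. (infdist (a x) C)\<^sup>2)"
      using assms(4,7) S(1) C(1) C0 nearest_assignment_in[OF assms(6)]
      by (intro weighted_cost_cells_eq_sum) auto
    have "\<bar>weighted_cost C S w - cost C X\<bar> \<le> (\<Sum>x\<in>X. \<bar>(infdist (a x) C)\<^sup>2 - (infdist x C)\<^sup>2\<bar>)"
      unfolding wc cost_eq_sum_infdist[OF C(1) C0] by (simp flip: sum_subtractf)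
    also have "\<dots> \<le> (\<Sum>x\<in>X. \<epsilon> / 2 * (infdist x C)\<^sup>2 + (2 / \<epsilon> + 1) * (norm (x - a x))\<^sup>2)"
      using assms(1) abs_diff_infdist_le[of "a _" C]
      by (intro sum_mono abs_diff_power2_le) (auto simp: infdist_nonneg simp flip: dist_norm)
    also have "\<dots> = \<epsilon> / 2 * cost C X + (2 / \<epsilon> + 1) * cost S X"
      unfolding cost_eq_sum_infdist[OF C(1) C0] cost_eq_sum_nearest_assignment[OF S(1) assms(6)]
      by (simp add: sum.distrib sum_distrib_left)
    also have "\<dots> \<le> \<epsilon> / 2 * cost C X + (2 / \<epsilon> + 1) * (\<epsilon>\<^sup>2 / 32 * cost C X)"
    proof -
      \<comment> \<open>The set \<open>C\<close> competes in the minimum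
        \<open>opt_cost k X\<close>.\<close>
      have "cost S X \<le> \<epsilon>\<^sup>2 / 32 * cost C X"
        using S(2) mult_left_mono[OF opt_cost_le_cost[OF assms(4,3) C], of "\<epsilon>\<^sup>2 / 32"] by simp
      then show ?thesis using assms(1) by (intro add_left_mono mult_left_mono) auto
    qed
    also have "\<dots> = (\<epsilon> / 2 + \<epsilon> / 16 + \<epsilon> * \<epsilon> / 32) * cost C X"
      using assms(1) by (simp add: power2_eq_square field_simps)
    also have "\<dots> \<le> \<epsilon> * cost C X"
    proof -
      \<comment> \<open>With \<open>\<epsilon> \<le> 1\<close> the coefficient is at most
        \<open>19 / 32 * \<epsilon>\<close>.\<close>
      have "\<epsilon> * \<epsilon> \<le> \<epsilon>" using assms(1,2) by (simp add: mult_left_le)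
      then have "\<epsilon> / 2 + \<epsilon> / 16 + \<epsilon> * \<epsilon> / 32 \<le> \<epsilon>" using assms(1) by linarith
      then show ?thesis by (intro mult_right_mono cost_nonneg[OF C(1) C0])
    qed
    finally show ?thesis .
  qed
  then show ?thesis
    using S(1) assms(7) by (auto simp: coreset_def abs_le_iff algebra_simps)
qed

end
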